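(* Let $n,k$ be positive integers such that $1\le k\le n-2$, and let $G\in\mathcal{G}_{n,k}$. Then: (i) For $\alpha=0$, $$\mu_\alpha(G)\ge \frac{n-2+\sqrt{n^2+4n-4k-4}}{2},$$ with equality if and only if $G\cong K(n,k,n-k-1)$ or $G\cong K(n,k,1)$. (ii) For $0<\alpha\le \frac45$, $$\mu_\alpha(G)\ge \frac{n-2+\alpha+\alpha n+\sqrt{(1-\alpha)^2n^2+(2\alpha^2-6\alpha+4)n+(\alpha^2+4\alpha-4)-4(1-\alpha)k}}{2},$$ with equality if and only if $G\cong K(n,k,1)$.
   Context: Digraphs are finite and simple (no loops, no multiple arcs; two opposite arcs $(u,v),(v,u)$ are allowed). A digraph is strongly connected if for every ordered pair of vertices there is a directed path from the first to the second. For a strongly connected digraph $G$ with vertices $v_1,\dots,v_n$, $D(G)=(d_{ij})$ is the distance matrix, where $d_{ij}$ is the length of a shortest directed path from $v_i$ to $v_j$; $D_i=\sum_{j=1}^n d_{ij}$ is the transmission of $v_i$; $Diag(Tr)=\mathrm{diag}(D_1,\dots,D_n)$; and $D_\alpha(G)=\alpha\, Diag(Tr)+(1-\alpha)D(G)$. The $D_\alpha$ spectral radius $\mu_\alpha(G)$ is the spectral radius of $D_\alpha(G)$, i.e. its eigenvalue of largest modulus. The vertex connectivity $\kappa(G)$ of a strongly connected digraph $G$ is the minimum number of vertices whose removal destroys strong connectivity (with value $n-1$ for the complete digraph on $n$ vertices). $\mathcal{G}_{n,k}$ is the set of strongly connected digraphs of order $n$ with $\kappa(G)=k$. For $1\le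 m\le n-k-1$, $K(n,k,m)$ is the digraph $\overset{\longleftrightarrow}{K_k}\vee(\overset{\longleftrightarrow}{K_{n-k-m}}\cup\overset{\longleftrightarrow}{K_m})+E$ with $E=\{(u,v):u\in V(\overset{\longleftrightarrow}{K_m}),\,v\in V(\overset{\longleftrightarrow}{K_{n-k-m}})\}$. Here $\overset{\longleftrightarrow}{K_r}$ is the complete digraph on $r$ vertices (both arcs between every two distinct vertices), $\cup$ is disjoint union, $G_1\vee G_2$ is the join (disjoint union together with all arcs in both directions between $G_1$ and $G_2$), and $+E$ means adding the arcs of $E$. *)

theory Defs
  imports
    "Graph_Theory.Graph_Theory"
    "Jordan_Normal_Form.Spectral_Radius"
begin

text \<open>Finite simple digraphs are the \<^locale>\<open>digraph\<close>s of Graph_Theory.\<close>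

definition ddist :: "('a, 'b) pre_digraph \<Rightarrow> 'a \<Rightarrow> 'a \<Rightarrow> nat" where
  "ddist G u v = (LEAST l. \<exists>p. pre_digraph.apath G u p v \<and> length p = l)"

definition transmission :: "('a, 'b) pre_digraph \<Rightarrow> 'a \<Rightarrow> nat" where
  "transmission G u = (\<Sum>v\<in>verts G. ddist G u v)"

text \<open>The matrices depend on an enumeration \<open>vs\<close> of the vertices, that is, a list with
  \<open>distinct vs\<close> and \<open>set vs = verts G\<close>.\<close>

definition distance_matrix :: "('a, 'b) pre_digraph \<Rightarrow> 'a list \<Rightarrow> real mat" where
  "distance_matrix G vs =
     mat (length vs) (length vs) (\<lambda>(i, j). real (ddist G (vs ! i) (vs ! j)))"

definition Diag_Tr :: "('a, 'b) pre_digraph \<Rightarrow> 'a list \<Rightarrow> real mat" where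
  "Diag_Tr G vs = mat_diag (length vs) (\<lambda>i. real (transmission G (vs ! i)))"

definition D_alpha :: "real \<Rightarrow> ('a, 'b) pre_digraph \<Rightarrow> 'a list \<Rightarrow> real mat" where
  "D_alpha \<alpha> G vs = \<alpha> \<cdot>\<^sub>m Diag_Tr G vs + (1 - \<alpha>) \<cdot>\<^sub>m distance_matrix G vs"

definition mu_alpha :: "real \<Rightarrow> ('a, 'b) pre_digraph \<Rightarrow> 'a list \<Rightarrow> real" where
  "mu_alpha \<alpha> G vs = spectral_radius (map_mat complex_of_real (D_alpha \<alpha> G vs))"

text \<open>A complete digraph needs its own case: deleting vertices destroys strong connectivity
  only when all of them are deleted, since \<^const>\<open>strongly_connected\<close> requires a vertex. In a
  non-complete digraph deleting all vertices but a suitable pair suffices, so the convention for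
  the null digraph plays no role there.\<close>

definition vertex_connectivity :: "('a, 'b) pre_digraph \<Rightarrow> nat" where
  "vertex_connectivity G =
     (if complete_digraph (card (verts G)) G then card (verts G) - 1
      else (LEAST k. \<exists>S\<subseteq>verts G. card S = k \<and>
              \<not> strongly_connected (G \<restriction> (verts G - S))))"

definition digraph_class :: "nat \<Rightarrow> nat \<Rightarrow> ('a, 'b) pre_digraph set" where
  "digraph_class n k =
     {G. digraph G \<and> strongly_connected G \<and> card (verts G) = n \<and> vertex_connectivity G = k}"

definition complete_di :: "nat \<Rightarrow> nat pair_pre_digraph" where
  "complete_di r = \<lparr> pverts = {..<r}, parcs = {(u, v). u < r \<and> v < r \<and> u \<noteq> v} \<rparr>"

definition disjoint_union ::
  "'a pair_pre_digraph \<Rightarrow> 'b pair_pre_digraph \<Rightarrow> ('a + 'b) pair_pre_digraph" where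
  "disjoint_union G H =
     \<lparr> pverts = Inl ` pverts G \<union> Inr ` pverts H,
       parcs = map_prod Inl Inl ` parcs G \<union> map_prod Inr Inr ` parcs H \<rparr>"

definition add_arcs :: "'a pair_pre_digraph \<Rightarrow> ('a \<times> 'a) set \<Rightarrow> 'a pair_pre_digraph" where
  "add_arcs G E = \<lparr> pverts = pverts G, parcs = parcs G \<union> E \<rparr>"

definition join ::
  "'a pair_pre_digraph \<Rightarrow> 'b pair_pre_digraph \<Rightarrow> ('a + 'b) pair_pre_digraph" where
  "join G H = add_arcs (disjoint_union G H)
     (Inl ` pverts G \<times> Inr ` pverts H \<union> Inr ` pverts H \<times> Inl ` pverts G)"

text \<open>Vertices \<open>Inl u\<close> form \<open>K\<^sub>k\<close>, vertices \<open>Inr (Inl u)\<close> form \<open>K\<^bsub>n-k-m\<^esub>\<close>, and vertices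
  \<open>Inr (Inr u)\<close> form \<open>K\<^sub>m\<close>. The digraph is meant for \<open>1 \<le> m \<le> n - k - 1\<close>.\<close>

definition K_digraph :: "nat \<Rightarrow> nat \<Rightarrow> nat \<Rightarrow> (nat + (nat + nat)) pair_pre_digraph" where
  "K_digraph n k m =
     add_arcs (join (complete_di k) (disjoint_union (complete_di (n - k - m)) (complete_di m)))
       {(Inr (Inr u), Inr (Inl v)) | u v. u \<in> pverts (complete_di m)
                                        \<and> v \<in> pverts (complete_di (n - k - m))}"

end

theory Submission
  imports Defs
begin

text \<open>
  Let \<open>S\<close> be a set of \<open>k\<close> vertices whose deletion destroys strong connectivity. The remaining vertices
  split into nonempty sets \<open>B\<close> and \<open>M\<close> without arcs from \<open>B\<close> to \<open>M\<close>, say with \<open>M\<close> of size \<open>m\<close>. Every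
  distance from \<open>B\<close> to \<open>M\<close> is then at least 2, and all other distances between distinct vertices are at
  least 1; these bounds are attained together exactly when \<open>G\<close> is \<open>K(n,k,m)\<close>
  (\<open>ddist_ge_forced\<close>, \<open>ddist_eq_forced_iff\<close>). So \<open>D\<^sub>\<alpha>(G)\<close> dominates \<open>D\<^sub>\<alpha>(K(n,k,m))\<close> entrywise.

  The matrix of \<open>K(n,k,m)\<close> has a positive eigenvector that takes two values, one on \<open>B\<close> and one outside,
  and its eigenvalue \<open>K_radius \<alpha> n k m\<close> is the larger root of an explicit quadratic polynomial. Used as a
  test vector for \<open>D\<^sub>\<alpha>(G)\<close>, it shows \<open>\<mu>\<^sub>\<alpha>(G) \<ge> K_radius \<alpha> n k m\<close>, with equality only for \<open>K(n,k,m)\<close>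
  (\<open>mu_alpha_ge_K_radius\<close>). What is needed of Perron--Frobenius theory is elementary: for a nonnegative
  matrix, \<open>A z \<ge> \<mu> z\<close> bounds the spectral radius from below, strictly if \<open>A\<close> has order at least 3
  and is positive off the diagonal and the inequality is strict somewhere, and \<open>A z \<le> \<mu> z\<close> with \<open>z > 0\<close> bounds it from above.

  Finally, comparing the quadratic polynomials shows that \<open>K_radius \<alpha> n k m\<close> is minimal for \<open>m = 1\<close>, and
  that the only other minimiser is \<open>m = n - k - 1\<close> in the case \<open>\<alpha> = 0\<close> (\<open>K_radius_mono\<close>). The bounds of
  the theorem are \<open>K_radius \<alpha> n k 1\<close> in closed form.
\<close>

section \<open>Spectral radius bounds for nonnegative matrices\<close>

lemma mult_mat_vec_index:
  assumes "A \<in> carrier_mat n n" "v \<in> carrier_vec n" "i < n"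
  shows "(A *\<^sub>v v) $ i = (\<Sum>j<n. A $$ (i, j) * v $ j)"
  using assms by (auto simp: scalar_prod_def lessThan_atLeast0 intro!: sum.cong)

lemma power_subinvariant_vec:
  fixes A :: "real mat"
  assumes A: "A \<in> carrier_mat n n" and nonneg: "\<And>i j. i < n \<Longrightarrow> j < n \<Longrightarrow> A $$ (i, j) \<ge> 0"
    and \<mu>: "\<mu> \<ge> 0"
    and sub: "\<And>i. i < n \<Longrightarrow> \<mu> * z i \<le> (\<Sum>j<n. A $$ (i, j) * z j)"
  shows "i < n \<Longrightarrow> \<mu> ^ l * z i \<le> (\<Sum>j<n. (A ^\<^sub>m l) $$ (i, j) * z j)"
proof (induction l arbitrary: i)
  case 0
  have "(\<Sum>j<n. (A ^\<^sub>m 0) $$ (i, j) * z j) = (\<Sum>j<n. if j = i then z j else 0)"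
    using A 0 by (intro sum.cong) auto
  then show ?case using 0 by simp
next
  case (Suc l)
  have Al: "A ^\<^sub>m l \<in> carrier_mat n n" using A by simp
  have pos: "(A ^\<^sub>m l) $$ (i, j) \<ge> 0" if "i < n" "j < n" for i j
    using that
  proof (induction l arbitrary: j)
    case 0 then show ?case using A by auto
  next
    case (Suc l)
    have "A ^\<^sub>m l \<in> carrier_mat n n" using A by simp
    then show ?case using Suc A nonneg
      by (auto simp: times_mat_def scalar_prod_def intro!: sum_nonneg)
  qed
  have "\<mu> ^ Suc l * z i = \<mu> * (\<mu> ^ l * z i)" by simp
  also have "\<dots> \<le> \<mu> * (\<Sum>j<n. (A ^\<^sub>m l) $$ (i, j) * z j)"
    using Suc \<mu> by (intro mult_left_mono) auto
  also have "\<dots> = (\<Sum>j<n. (A ^\<^sub>m l) $$ (i, j) * (\<mu> * z j))"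
    by (simp add: sum_distrib_left algebra_simps)
  also have "\<dots> \<le> (\<Sum>j<n. (A ^\<^sub>m l) $$ (i, j) * (\<Sum>h<n. A $$ (j, h) * z h))"
    using pos Suc.prems sub by (intro sum_mono mult_left_mono) auto
  also have "\<dots> = (\<Sum>h<n. (\<Sum>j<n. (A ^\<^sub>m l) $$ (i, j) * A $$ (j, h)) * z h)"
    by (simp add: sum_distrib_left sum_distrib_right mult.assoc) (rule sum.swap)
  also have "\<dots> = (\<Sum>h<n. (A ^\<^sub>m Suc l) $$ (i, h) * z h)"
    using A Al Suc.prems
    by (intro sum.cong) (auto simp: times_mat_def scalar_prod_def lessThan_atLeast0 intro!: sum.cong)
  finally show ?case .
qed

text \<open>Rescaling to spectral radius below 1 makes the powers of the matrix bounded, which is how the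
spectral radius enters the next lemma.\<close>

lemma spectral_radius_smult_less_1:
  fixes A :: "complex mat"
  assumes A: "A \<in> carrier_mat n n" and n: "n > 0" and c: "spectral_radius A < c" "c > 0"
  shows "spectral_radius (of_real (1 / c) \<cdot>\<^sub>m A) < 1"
proof -
  let ?B = "of_real (1 / c) \<cdot>\<^sub>m A :: complex mat"
  have B: "?B \<in> carrier_mat n n" using A by simp
  obtain l where l: "eigenvalue ?B l" "spectral_radius ?B = norm l"
    using spectral_radius_mem_max(1)[OF B n] by (auto simp: spectrum_def)
  then obtain v where v: "v \<in> carrier_vec n" "v \<noteq> 0\<^sub>v n" "?B *\<^sub>v v = l \<cdot>\<^sub>v v"
    using B by (auto simp: eigenvalue_def eigenvector_def)
  have "A *\<^sub>v v = (of_real c * l) \<cdot>\<^sub>v v"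
  proof (rule eq_vecI)
    fix i assume "i < dim_vec ((of_real c * l) \<cdot>\<^sub>v v)"
    then have i: "i < n" using v by simp
    have "l * v $ i = (\<Sum>j<n. ?B $$ (i, j) * v $ j)"
      using arg_cong[OF v(3), of "\<lambda>w. w $ i"] mult_mat_vec_index[OF B v(1) i] v(1) i by simp
    also have "\<dots> = (A *\<^sub>v v) $ i / of_real c"
      unfolding mult_mat_vec_index[OF A v(1) i] sum_divide_distrib using A i by (intro sum.cong) auto
    finally show "(A *\<^sub>v v) $ i = ((of_real c * l) \<cdot>\<^sub>v v) $ i"
      using c i v by (simp add: field_simps)
  qed (use A v in auto)
  then have "eigenvalue A (of_real c * l)"
    using A v by (auto simp: eigenvalue_def eigenvector_def)
  then have "norm (of_real c * l) \<le> spectral_radius A"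
    using spectral_radius_mem_max(2)[OF A n] by (auto simp: spectrum_def)
  then have "c * norm l \<le> spectral_radius A" using c by (simp add: norm_mult)
  then have "c * norm l < c * 1" using c by linarith
  then show ?thesis using l(2) mult_less_cancel_left_pos[OF c(2)] by metis
qed

text \<open>If \<open>A z \<ge> \<mu> z\<close> and the spectral radius were below some \<open>c < \<mu>\<close>, then the powers of \<open>A / c\<close> would be
bounded, whereas \<open>(A / c)\<^sup>l z \<ge> (\<mu> / c)\<^sup>l z\<close> grows without bound.\<close>

lemma spectral_radius_ge_subinvariant:
  fixes A :: "real mat"
  assumes A: "A \<in> carrier_mat n n" and nonneg: "\<And>i j. i < n \<Longrightarrow> j < n \<Longrightarrow> A $$ (i, j) \<ge> 0"
    and z: "\<And>i. i < n \<Longrightarrow> z i \<ge> 0" and i0: "i0 < n" "z i0 > 0"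
    and sub: "\<And>i. i < n \<Longrightarrow> \<mu> * z i \<le> (\<Sum>j<n. A $$ (i, j) * z j)"
  shows "\<mu> \<le> spectral_radius (map_mat complex_of_real A)"
proof (rule ccontr)
  let ?C = "map_mat complex_of_real A"
  have C: "?C \<in> carrier_mat n n" and n: "n > 0" using A i0 by auto
  have "spectral_radius ?C \<ge> 0"
    using spectral_radius_mem_max(1)[OF C n] by auto
  assume "\<not> \<mu> \<le> spectral_radius ?C"
  then obtain c where c: "spectral_radius ?C < c" "c < \<mu>"
    using dense by (meson not_le)
  then have c0: "c > 0" using \<open>spectral_radius ?C \<ge> 0\<close> by linarith
  define B where "B = (1 / c) \<cdot>\<^sub>m A"
  have B: "B \<in> carrier_mat n n" using A by (simp add: B_def)
  have BC: "map_mat complex_of_real B = of_real (1 / c) \<cdot>\<^sub>m ?C"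
    using A by (intro eq_matI) (auto simp: B_def)
  have "spectral_radius (map_mat complex_of_real B) < 1"
    unfolding BC by (rule spectral_radius_smult_less_1[OF C n c(1) c0])
  then obtain b where b: "\<And>l. norm_bound (map_mat complex_of_real B ^\<^sub>m l) b"
    using spectral_radius_jnf_norm_bound_less_1_upper_triangular[of "map_mat complex_of_real B" n] B
    by auto
  have entry: "(B ^\<^sub>m l) $$ (i, j) \<le> b" if "i < n" "j < n" for l i j
  proof -
    have Bl: "B ^\<^sub>m l \<in> carrier_mat n n" using B by simp
    have "map_mat complex_of_real B ^\<^sub>m l = map_mat complex_of_real (B ^\<^sub>m l)"
      using B by (simp add: of_real_hom.mat_hom_pow)
    with b[of l] have "norm (complex_of_real ((B ^\<^sub>m l) $$ (i, j))) \<le> b"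
      using that Bl carrier_matD[OF B] by (auto simp: norm_bound_def)
    then show ?thesis by simp
  qed
  have subB: "(\<mu> / c) * z i \<le> (\<Sum>j<n. B $$ (i, j) * z j)" if "i < n" for i
  proof -
    have "(\<Sum>j<n. B $$ (i, j) * z j) = (\<Sum>j<n. A $$ (i, j) * z j) / c"
      using A that by (auto simp: B_def sum_divide_distrib intro!: sum.cong)
    then show ?thesis using sub[OF that] c0 by (simp add: divide_simps)
  qed
  have bound: "(\<mu> / c) ^ l \<le> b * (\<Sum>j<n. z j) / z i0" for l
  proof -
    have "(\<mu> / c) ^ l * z i0 \<le> (\<Sum>j<n. (B ^\<^sub>m l) $$ (i0, j) * z j)"
      using A nonneg c0 c(2) subB i0(1)
      by (intro power_subinvariant_vec[OF B]) (auto simp: B_def)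
    also have "\<dots> \<le> (\<Sum>j<n. b * z j)"
      using entry i0 z by (intro sum_mono mult_right_mono) auto
    finally show ?thesis using i0 by (simp add: sum_distrib_left field_simps)
  qed
  have "1 < \<mu> / c" using c c0 by simp
  from real_arch_pow[OF this] bound show False by (meson not_le)
qed

text \<open>For an eigenvector \<open>v\<close>, evaluate the eigenvalue equation at an index where \<open>\<bar>v\<^sub>i\<bar> / z\<^sub>i\<close> is largest: there
the triangle inequality and \<open>A z \<le> \<mu> z\<close> bound the modulus of the eigenvalue by \<open>\<mu>\<close>.\<close>

lemma spectral_radius_le_superinvariant:
  fixes A :: "real mat"
  assumes A: "A \<in> carrier_mat n n" and n: "n > 0"
    and nonneg: "\<And>i j. i < n \<Longrightarrow> j < n \<Longrightarrow> A $$ (i, j) \<ge> 0"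
    and z: "\<And>i. i < n \<Longrightarrow> z i > 0"
    and sup: "\<And>i. i < n \<Longrightarrow> (\<Sum>j<n. A $$ (i, j) * z j) \<le> \<mu> * z i"
  shows "spectral_radius (map_mat complex_of_real A) \<le> \<mu>"
proof -
  let ?C = "map_mat complex_of_real A"
  have C: "?C \<in> carrier_mat n n" using A by simp
  obtain l where l: "eigenvalue ?C l" "spectral_radius ?C = norm l"
    using spectral_radius_mem_max(1)[OF C n] by (auto simp: spectrum_def)
  then obtain v where v: "v \<in> carrier_vec n" "v \<noteq> 0\<^sub>v n" "?C *\<^sub>v v = l \<cdot>\<^sub>v v"
    using C by (auto simp: eigenvalue_def eigenvector_def)
  define q where "q i = norm (v $ i) / z i" for i
  have "Max (q ` {..<n}) \<in> q ` {..<n}" using n by (intro Max_in) auto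
  then obtain i where i: "i < n" "\<And>j. j < n \<Longrightarrow> q j \<le> q i"
    by (metis (no_types, lifting) Max_ge finite_imageI finite_lessThan imageE imageI lessThan_iff)
  have vq: "norm (v $ j) = q j * z j" if "j < n" for j using z[OF that] by (simp add: q_def)
  obtain j where "j < n" "v $ j \<noteq> 0"
    using v by (metis carrier_vecD eq_vecI index_zero_vec)
  then have "q j > 0" using z by (simp add: q_def)
  then have qi: "q i > 0" using i(2)[OF \<open>j < n\<close>] by simp
  have "l * v $ i = (\<Sum>j<n. ?C $$ (i, j) * v $ j)"
    using arg_cong[OF v(3), of "\<lambda>w. w $ i"] mult_mat_vec_index[OF C v(1) i(1)] v(1) i(1) by simp
  then have "norm l * norm (v $ i) = norm (\<Sum>j<n. ?C $$ (i, j) * v $ j)"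
    by (metis norm_mult)
  also have "\<dots> \<le> (\<Sum>j<n. A $$ (i, j) * norm (v $ j))"
    using A i nonneg by (intro sum_norm_le) (auto simp: norm_mult)
  also have "\<dots> \<le> (\<Sum>j<n. A $$ (i, j) * (q i * z j))"
    using nonneg i vq z by (intro sum_mono mult_left_mono) (auto intro!: mult_right_mono less_imp_le)
  also have "\<dots> = q i * (\<Sum>j<n. A $$ (i, j) * z j)"
    by (simp add: sum_distrib_left algebra_simps)
  also have "\<dots> \<le> q i * (\<mu> * z i)" using sup[OF i(1)] qi by simp
  finally have "norm l * (q i * z i) \<le> \<mu> * (q i * z i)" using vq[OF i(1)] by (simp add: algebra_simps)
  then show ?thesis using l qi z[OF i(1)] by simp
qed

text \<open>A single strict inequality in \<open>A z \<ge> \<mu> z\<close> spreads to all coordinates after two more applications of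
\<open>A\<close>: the residual \<open>r = A z - \<mu> z\<close> is nonnegative and nonzero, and \<open>A\<^sup>2 r\<close> is positive, because
between any two indices (even equal ones) there is a third one to pass through when \<open>n \<ge> 3\<close>. Passing
through a third index avoids the diagonal, which is zero in \<open>D\<^sub>\<alpha>\<close> for \<open>\<alpha> = 0\<close>. So \<open>w = A\<^sup>2 z\<close> satisfies
\<open>A w \<ge> (\<mu> + \<epsilon>) w\<close> for some \<open>\<epsilon> > 0\<close>.\<close>

lemma spectral_radius_gt_subinvariant:
  fixes A :: "real mat"
  assumes A: "A \<in> carrier_mat n n" and n: "n \<ge> 3"
    and nonneg: "\<And>i j. i < n \<Longrightarrow> j < n \<Longrightarrow> A $$ (i, j) \<ge> 0"
    and off: "\<And>i j. i < n \<Longrightarrow> j < n \<Longrightarrow> i \<noteq> j \<Longrightarrow> A $$ (i, j) > 0"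
    and z: "\<And>i. i < n \<Longrightarrow> z i > 0"
    and sub: "\<And>i. i < n \<Longrightarrow> \<mu> * z i \<le> (\<Sum>j<n. A $$ (i, j) * z j)"
    and i0: "i0 < n" "\<mu> * z i0 < (\<Sum>j<n. A $$ (i0, j) * z j)"
  shows "\<mu> < spectral_radius (map_mat complex_of_real A)"
proof -
  define T where "T y i = (\<Sum>j<n. A $$ (i, j) * y j)" for y i
  have T_pos: "T y i > 0"
    if "i < n" "j < n" "i \<noteq> j" "y j > 0" "\<And>h. h < n \<Longrightarrow> y h \<ge> 0" for y i j
    unfolding T_def using that nonneg off by (intro sum_pos2[of _ j]) auto
  have T_nonneg: "T y i \<ge> 0" if "i < n" "\<And>h. h < n \<Longrightarrow> y h \<ge> 0" for y i
    unfolding T_def using that nonneg by (intro sum_nonneg) auto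
  have other: "\<exists>j<n. j \<noteq> i \<and> j \<noteq> i0" for i
  proof -
    have "\<not> {..<n} \<subseteq> {i, i0}"
      using n card_mono[of "{i, i0}" "{..<n}"] card_insert_le_m1[of 2 "{i0}" i] by auto
    then show ?thesis by auto
  qed
  define r where "r i = T z i - \<mu> * z i" for i
  have r: "r i \<ge> 0" if "i < n" for i using sub[OF that] by (simp add: r_def T_def)
  have r0: "r i0 > 0" using i0 by (simp add: r_def T_def)
  have TTr: "T (T r) i > 0" if i: "i < n" for i
  proof -
    obtain j where j: "j < n" "j \<noteq> i" "j \<noteq> i0" using other by blast
    have "T r j > 0" using T_pos[of j i0 r] j i0 r r0 by auto
    then show ?thesis using T_pos[of i j "T r"] i j T_nonneg r by auto
  qed
  define w where "w = T (T z)"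
  have w: "w i > 0" if i: "i < n" for i
  proof -
    obtain j where j: "j < n" "j \<noteq> i" using other by blast
    have Tz: "T z h > 0" if "h < n" for h
    proof -
      obtain g where "g < n" "g \<noteq> h" using other by blast
      then show ?thesis using T_pos[of h g z] z that by (auto simp: less_imp_le)
    qed
    then show ?thesis unfolding w_def using T_pos[of i j "T z"] i j by (auto simp: less_imp_le)
  qed
  \<comment> \<open>Linearity turns the residual of \<open>w\<close> into the twofold image of the residual \<open>r\<close> of \<open>z\<close>.\<close>
  have T_diff: "T (\<lambda>i. y i - \<mu> * x i) = (\<lambda>i. T y i - \<mu> * T x i)" for x y
    by (rule ext) (simp add: T_def algebra_simps sum_subtractf sum_distrib_left)
  have "r = (\<lambda>i. T z i - \<mu> * z i)" by (rule ext) (simp add: r_def)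
  then have TTr_eq: "T (T r) = (\<lambda>i. T w i - \<mu> * w i)" by (simp add: T_diff w_def)
  define \<epsilon> where "\<epsilon> = Min ((\<lambda>i. T (T r) i / w i) ` {..<n})"
  have "{..<n} \<noteq> {}" using n by (auto simp: lessThan_empty_iff)
  then have "\<epsilon> > 0" unfolding \<epsilon>_def using TTr w by (subst Min_gr_iff) auto
  have "(\<mu> + \<epsilon>) * w i \<le> (\<Sum>j<n. A $$ (i, j) * w j)" if i: "i < n" for i
  proof -
    have "\<epsilon> \<le> T (T r) i / w i" unfolding \<epsilon>_def using i by (intro Min_le) auto
    then have "\<epsilon> * w i \<le> T w i - \<mu> * w i" using w[OF i] by (simp add: TTr_eq field_simps)
    then show ?thesis by (simp add: T_def algebra_simps)
  qed
  then have "\<mu> + \<epsilon> \<le> spectral_radius (map_mat complex_of_real A)"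
    using w n by (intro spectral_radius_ge_subinvariant[OF A nonneg, of w 0]) (auto simp: less_imp_le)
  then show ?thesis using \<open>\<epsilon> > 0\<close> by linarith
qed

section \<open>Distances\<close>

context digraph begin

lemma ddist_refl: "u \<in> verts G \<Longrightarrow> ddist G u u = 0"
  unfolding ddist_def by (rule Least_eq_0) (auto simp: apath_Nil_iff)

lemma ddist_attained:
  assumes "u \<rightarrow>\<^sup>* v"
  obtains p where "apath u p v" "length p = ddist G u v"
proof -
  have "\<exists>l p. apath u p v \<and> length p = l" using assms by (auto simp: reachable_apath)
  from LeastI_ex[OF this] that show thesis unfolding ddist_def by blast
qed

lemma ddist_le: "apath u p v \<Longrightarrow> ddist G u v \<le> length p"
  unfolding ddist_def by (rule Least_le) auto

lemma ddist_ge_1: "u \<rightarrow>\<^sup>* v \<Longrightarrow> u \<noteq> v \<Longrightarrow> ddist G u v \<ge> 1"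
  by (erule ddist_attained, case_tac p) (auto simp: apath_Nil_iff)

lemma ddist_ge_2:
  assumes "u \<rightarrow>\<^sup>* v" "u \<noteq> v" "\<not> u \<rightarrow> v"
  shows "ddist G u v \<ge> 2"
proof -
  obtain p where p: "apath u p v" "length p = ddist G u v" using assms ddist_attained by blast
  have "length p \<noteq> 0" using p(1) assms by (auto simp: apath_Nil_iff)
  moreover have "length p \<noteq> 1"
  proof
    assume "length p = 1"
    then obtain e where "p = [e]" by (auto simp: length_Suc_conv)
    then show False using p(1) assms by (auto simp: apath_simps arcs_ends_conv)
  qed
  ultimately show ?thesis using p(2) by linarith
qed

lemma ddist_adj:
  assumes "u \<rightarrow> v"
  shows "ddist G u v = 1"
proof -
  have uv: "u \<noteq> v" using assms adj_not_same by blast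
  obtain e where "e \<in> arcs G" "tail G e = u" "head G e = v" using assms by blast
  then have "apath u [e] v" using uv by (auto simp: apath_simps)
  then have "ddist G u v \<le> 1" using ddist_le by fastforce
  then show ?thesis using ddist_ge_1[of u v] assms uv by fastforce
qed

lemma ddist_eq_2:
  assumes "u \<rightarrow> w" "w \<rightarrow> v" "u \<noteq> v" "\<not> u \<rightarrow> v"
  shows "ddist G u v = 2"
proof -
  have "u \<noteq> w" "w \<noteq> v" using assms adj_not_same by blast+
  moreover obtain e f where "e \<in> arcs G" "tail G e = u" "head G e = w"
    "f \<in> arcs G" "tail G f = w" "head G f = v" using assms(1,2) by blast
  ultimately have "apath u [e, f] v" using assms by (auto simp: apath_simps)
  then have "ddist G u v \<le> 2" using ddist_le by fastforce
  moreover have "u \<rightarrow>\<^sup>* v" using assms by (blast intro: adj_reachable_trans)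
  ultimately show ?thesis using ddist_ge_2 assms by (meson le_antisym)
qed

end

section \<open>Cuts and the extremal digraphs\<close>

text \<open>\<open>B\<close> is the set of vertices reachable from \<open>u\<close> after deleting \<open>S\<close>, for a pair \<open>u\<close>, \<open>v\<close> witnessing that
strong connectivity is lost.\<close>

lemma disconnecting_partition:
  assumes G: "digraph G" and S: "S \<subseteq> verts G"
    and ns: "\<not> strongly_connected (G \<restriction> (verts G - S))" and ne: "verts G - S \<noteq> {}"
  obtains B M where "B \<union> M = verts G - S" "B \<inter> M = {}" "B \<noteq> {}" "M \<noteq> {}"
    "\<And>u v. u \<in> B \<Longrightarrow> v \<in> M \<Longrightarrow> (u, v) \<notin> arcs_ends G"
proof -
  interpret digraph G by (rule G)
  let ?H = "G \<restriction> (verts G - S)"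
  interpret H: wf_digraph ?H by (rule wellformed_induce_subgraph)
  obtain u v where uv: "u \<in> verts G - S" "v \<in> verts G - S" "\<not> u \<rightarrow>\<^sup>*\<^bsub>?H\<^esub> v"
    using ns ne by (auto simp: strongly_connected_def)
  define B where "B = {w. u \<rightarrow>\<^sup>*\<^bsub>?H\<^esub> w}"
  have "B \<subseteq> verts G - S" unfolding B_def using H.reachable_in_verts(2) by fastforce
  moreover have "u \<in> B" using uv by (simp add: B_def H.reachable_refl)
  moreover have "(x, y) \<notin> arcs_ends G" if "x \<in> B" "y \<in> verts G - S - B" for x y
  proof
    assume "(x, y) \<in> arcs_ends G"
    then have "(x, y) \<in> arcs_ends ?H"
      using that \<open>B \<subseteq> verts G - S\<close> by (auto simp: arcs_ends_conv image_iff)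
    then show False using that H.reachable_adj_trans by (auto simp: B_def)
  qed
  moreover have "v \<notin> B" using uv by (simp add: B_def)
  ultimately show thesis using uv by (intro that[of B "verts G - S - B"]) auto
qed

text \<open>For simple digraphs of order \<open>n\<close> and disjoint \<open>B\<close> and \<open>M\<close> with \<open>n - k - m\<close> and \<open>m\<close> vertices, this describes
\<open>K(n,k,m)\<close> without reference to its concrete vertices.\<close>

definition complete_except :: "('a, 'b) pre_digraph \<Rightarrow> 'a set \<Rightarrow> 'a set \<Rightarrow> bool" where
  "complete_except G B M \<longleftrightarrow>
     arcs_ends G = {(u, v). u \<in> verts G \<and> v \<in> verts G \<and> u \<noteq> v \<and> \<not> (u \<in> B \<and> v \<in> M)}"

lemma verts_K_digraph:
  "pverts (K_digraph n k m) =
     Inl ` {..<k} \<union> Inr ` (Inl ` {..<n - k - m} \<union> Inr ` {..<m})"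
  by (auto simp: K_digraph_def add_arcs_def join_def disjoint_union_def complete_di_def)

lemma parcs_K_digraph:
  "parcs (K_digraph n k m) =
     {(u, v). u \<in> pverts (K_digraph n k m) \<and> v \<in> pverts (K_digraph n k m) \<and> u \<noteq> v \<and>
        \<not> (u \<in> Inr ` Inl ` {..<n - k - m} \<and> v \<in> Inr ` Inr ` {..<m})}"
  (is "?L = ?R")
proof -
  have mem: "(x, y) \<in> map_prod f g ` A \<longleftrightarrow> (\<exists>a b. (a, b) \<in> A \<and> x = f a \<and> y = g b)"
    for x y A and f :: "'x \<Rightarrow> 'z" and g :: "'y \<Rightarrow> 'w"
    by force
  have img: "x \<in> Inl ` A \<longleftrightarrow> (\<exists>a\<in>A. x = Inl a)" "y \<in> Inr ` A' \<longleftrightarrow> (\<exists>a\<in>A'. y = Inr a)"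
    for x :: "'x + 'y" and A and y :: "'z + 'w" and A'
    by auto
  have types: "thesis" if "\<And>a. u = Inl a \<Longrightarrow> thesis" "\<And>a. u = Inr (Inl a) \<Longrightarrow> thesis"
    "\<And>a. u = Inr (Inr a) \<Longrightarrow> thesis" for thesis and u :: "nat + (nat + nat)"
    using that by (metis sum.exhaust)
  have "(u, v) \<in> ?L \<longleftrightarrow> (u, v) \<in> ?R" for u v
    unfolding verts_K_digraph
    by (rule types[of u]; rule types[of v])
      (simp_all add: K_digraph_def add_arcs_def join_def disjoint_union_def complete_di_def
        mem img)
  then show ?thesis by (intro equalityI subrelI) blast+
qed

text \<open>Without multiple arcs the bijection of the arcs is determined by that of the vertices.\<close>

lemma digraph_iso_with_proj_iff:
  fixes G :: "('a, 'b) pre_digraph" and H :: "'c pair_pre_digraph"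
  assumes "digraph G"
  shows "digraph_iso G (with_proj H) \<longleftrightarrow>
     (\<exists>f. bij_betw f (verts G) (pverts H) \<and> parcs H = map_prod f f ` arcs_ends G)"
    (is "?L \<longleftrightarrow> ?R")
proof
  interpret digraph G by (rule assms)
  {
    assume ?L
    then obtain h where h: "digraph_isomorphism h" "with_proj H = app_iso h G"
      by (auto simp: digraph_iso_def)
    let ?f = "iso_verts h"
    have t: "iso_tail h = fst" "iso_head h = snd" "pverts H = ?f ` verts G"
      "parcs H = iso_arcs h ` arcs G"
      using h(2) by (auto simp: app_iso_def with_proj_def)
    have "iso_arcs h e = map_prod ?f ?f (arc_to_ends G e)" if "e \<in> arcs G" for e
      using h(1) that t by (auto simp: digraph_isomorphism_def arc_to_ends_def prod_eq_iff)
    then have "parcs H = map_prod ?f ?f ` arcs_ends G"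
      unfolding t arcs_ends_def image_image by (intro image_cong) auto
    moreover have "bij_betw ?f (verts G) (pverts H)"
      using h(1) t by (auto simp: digraph_isomorphism_def bij_betw_def)
    ultimately show ?R by blast
  }
  assume ?R
  then obtain f where f: "bij_betw f (verts G) (pverts H)" "parcs H = map_prod f f ` arcs_ends G"
    by blast
  define h where "h = \<lparr> iso_verts = f, iso_arcs = (\<lambda>e. (f (tail G e), f (head G e))),
    iso_head = snd, iso_tail = fst \<rparr>"
  have "inj_on f (verts G)" using f(1) by (simp add: bij_betw_def)
  then have "inj_on (iso_arcs h) (arcs G)"
    by (intro inj_onI no_multi_arcs)
      (auto simp: h_def arc_to_ends_def dest: inj_onD)
  then have "digraph_isomorphism h"
    using \<open>inj_on f (verts G)\<close> wf_digraph by (auto simp: digraph_isomorphism_def h_def)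
  moreover have "with_proj H = app_iso h G"
    using f by (auto simp: app_iso_def with_proj_def h_def bij_betw_def arcs_ends_conv image_image)
  ultimately show ?L by (auto simp: digraph_iso_def)
qed

text \<open>From left to right, \<open>B\<close> and \<open>M\<close> are preimages of the blocks of \<open>K(n,k,m)\<close>; conversely, bijections of
the three blocks, which exist by cardinality, are glued together.\<close>

lemma digraph_iso_K_digraph_iff:
  fixes G :: "('a, 'b) pre_digraph"
  assumes G: "digraph G" and nkm: "k + m \<le> n"
  shows "digraph_iso G (with_proj (K_digraph n k m)) \<longleftrightarrow>
     card (verts G) = n \<and>
     (\<exists>B M. B \<subseteq> verts G \<and> M \<subseteq> verts G \<and> B \<inter> M = {} \<and> card B = n - k - m \<and> card M = m \<and>
        complete_except G B M)"
    (is "?L \<longleftrightarrow> ?R")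
proof
  interpret digraph G by (rule G)
  let ?H = "K_digraph n k m"
  define B' where "B' = (Inr ` Inl ` {..<n - k - m} :: (nat + (nat + nat)) set)"
  define M' where "M' = (Inr ` Inr ` {..<m} :: (nat + (nat + nat)) set)"
  define S' where "S' = (Inl ` {..<k} :: (nat + (nat + nat)) set)"
  have card': "card B' = n - k - m" "card M' = m" "card S' = k"
    by (simp_all add: B'_def M'_def S'_def card_image inj_on_def)
  have fin': "finite B'" "finite M'" "finite S'" by (simp_all add: B'_def M'_def S'_def)
  have H: "pverts ?H = S' \<union> (B' \<union> M')"
    unfolding verts_K_digraph B'_def M'_def S'_def by (simp add: image_Un)
  have dis: "B' \<inter> M' = {}" "S' \<inter> (B' \<union> M') = {}"
    unfolding B'_def M'_def S'_def by auto
  have card_H: "card (pverts ?H) = n"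
    unfolding H using dis card' fin' nkm by (simp add: card_Un_disjoint)
  have arcs_H: "(x, y) \<in> parcs ?H \<longleftrightarrow>
      x \<in> pverts ?H \<and> y \<in> pverts ?H \<and> x \<noteq> y \<and> \<not> (x \<in> B' \<and> y \<in> M')" for x y
    unfolding parcs_K_digraph B'_def M'_def by simp
  {
    assume ?L
    then obtain f where f: "bij_betw f (verts G) (pverts ?H)"
      "parcs ?H = map_prod f f ` arcs_ends G"
      unfolding digraph_iso_with_proj_iff[OF G] by blast
    have inj: "inj_on f (verts G)" and img: "f ` verts G = pverts ?H"
      using f(1) by (simp_all add: bij_betw_def)
    define B where "B = {v \<in> verts G. f v \<in> B'}"
    define M where "M = {v \<in> verts G. f v \<in> M'}"
    have preimage: "f ` {v \<in> verts G. f v \<in> X} = X" if "X \<subseteq> f ` verts G" for X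
      using that by auto
    have "f ` B = B'" "f ` M = M'" unfolding B_def M_def by (rule preimage; auto simp: img H)+
    moreover have sub: "B \<subseteq> verts G" "M \<subseteq> verts G" by (auto simp: B_def M_def)
    ultimately have "card B = n - k - m" "card M = m"
      using card_image[OF inj_on_subset[OF inj]] card' by metis+
    moreover have "card (verts G) = n" using bij_betw_same_card[OF f(1)] card_H by simp
    moreover have "B \<inter> M = {}" using dis(1) by (auto simp: B_def M_def)
    moreover have "complete_except G B M"
      unfolding complete_except_def
    proof (intro equalityI subrelI)
      fix u v assume uv: "(u, v) \<in> arcs_ends G"
      then have V: "u \<in> verts G" "v \<in> verts G" using adj_in_verts by auto
      have "(f u, f v) \<in> parcs ?H" unfolding f(2) using uv by (rule map_prod_imageI)
      then show "(u, v) \<in> {(u, v). u \<in> verts G \<and> v \<in> verts G \<and> u \<noteq> v \<and> \<not> (u \<in> B \<and> v \<in> M)}"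
        unfolding arcs_H B_def M_def using V by auto
    next
      fix u v
      assume "(u, v) \<in> {(u, v). u \<in> verts G \<and> v \<in> verts G \<and> u \<noteq> v \<and> \<not> (u \<in> B \<and> v \<in> M)}"
      then have uv: "u \<in> verts G" "v \<in> verts G" "u \<noteq> v" "\<not> (u \<in> B \<and> v \<in> M)" by auto
      then have "f u \<in> pverts ?H" "f v \<in> pverts ?H" "f u \<noteq> f v" "\<not> (f u \<in> B' \<and> f v \<in> M')"
        using img inj_on_eq_iff[OF inj] unfolding B_def M_def by blast+
      then have "(f u, f v) \<in> map_prod f f ` arcs_ends G" using arcs_H f(2) by metis
      then obtain x y where xy: "(x, y) \<in> arcs_ends G" "f u = f x" "f v = f y" by auto
      then have "x \<in> verts G" "y \<in> verts G" using adj_in_verts by auto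
      then show "(u, v) \<in> arcs_ends G" using xy uv(1,2) inj_on_eq_iff[OF inj] by metis
    qed
    ultimately show ?R using sub by blast
  }
  assume ?R
  then obtain B M where BM: "B \<subseteq> verts G" "M \<subseteq> verts G" "B \<inter> M = {}" "card B = n - k - m"
    "card M = m" "complete_except G B M" and n: "card (verts G) = n" by blast
  define S where "S = verts G - (B \<union> M)"
  have fin: "finite B" "finite M" using BM finite_subset finite_verts by blast+
  have "card (B \<union> M) = n - k" using BM fin nkm by (simp add: card_Un_disjoint)
  then have "card S = k" unfolding S_def using BM n nkm fin by (subst card_Diff_subset) auto
  have finS: "finite S" by (simp add: S_def)
  obtain fS where fS: "bij_betw fS S S'"
    using finite_same_card_bij[OF finS fin'(3)] \<open>card S = k\<close> card' by metis
  obtain fB where fB: "bij_betw fB B B'"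
    using finite_same_card_bij[OF fin(1) fin'(1)] BM card' by metis
  obtain fM where fM: "bij_betw fM M M'"
    using finite_same_card_bij[OF fin(2) fin'(2)] BM card' by metis
  define f where "f v = (if v \<in> S then fS v else if v \<in> B then fB v else fM v)" for v
  have bS: "bij_betw f S S'" using fS by (rule bij_betw_cong[THEN iffD1, rotated]) (simp add: f_def)
  have bB: "bij_betw f B B'"
    using fB by (rule bij_betw_cong[THEN iffD1, rotated]) (simp add: f_def S_def)
  have "v \<notin> B" if "v \<in> M" for v using BM(3) that by auto
  then have bM: "bij_betw f M M'"
    using fM by (intro bij_betw_cong[THEN iffD1, OF _ fM]) (simp add: f_def S_def)
  have V: "verts G = S \<union> (B \<union> M)" using BM by (auto simp: S_def)
  have bij: "bij_betw f (verts G) (pverts ?H)"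
    unfolding V H by (intro bij_betw_combine bS bB bM dis)
  have inj: "inj_on f (verts G)" and img: "f ` verts G = pverts ?H"
    using bij by (simp_all add: bij_betw_def)
  have iB: "f v \<in> B' \<longleftrightarrow> v \<in> B" and iM: "f v \<in> M' \<longleftrightarrow> v \<in> M" if "v \<in> verts G" for v
    using inj_on_image_mem_iff[OF inj that BM(1)] inj_on_image_mem_iff[OF inj that BM(2)] bB bM
    by (simp_all add: bij_betw_def)
  have "parcs ?H = map_prod f f ` arcs_ends G"
  proof (intro equalityI subrelI)
    fix x y assume xy: "(x, y) \<in> parcs ?H"
    then obtain u v where uv: "u \<in> verts G" "v \<in> verts G" "x = f u" "y = f v"
      unfolding arcs_H img[symmetric] by blast
    then have "u \<noteq> v" "\<not> (u \<in> B \<and> v \<in> M)" using xy iB iM unfolding arcs_H by auto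
    then have "(u, v) \<in> arcs_ends G" using BM(6) uv unfolding complete_except_def by simp
    then show "(x, y) \<in> map_prod f f ` arcs_ends G" unfolding uv by (rule map_prod_imageI)
  next
    fix x y assume "(x, y) \<in> map_prod f f ` arcs_ends G"
    then obtain u v where xy: "x = f u" "y = f v" and "(u, v) \<in> arcs_ends G" by auto
    then have uv: "u \<in> verts G" "v \<in> verts G" "u \<noteq> v" "\<not> (u \<in> B \<and> v \<in> M)"
      using BM(6) unfolding complete_except_def by simp_all
    then show "(x, y) \<in> parcs ?H"
      unfolding arcs_H xy using inj_on_eq_iff[OF inj] img iB iM by blast
  qed
  then show ?L unfolding digraph_iso_with_proj_iff[OF G] using bij by blast
qed

section \<open>The spectral radius of the extremal digraphs\<close>

text \<open>The larger eigenvalue of the quotient matrix of \<open>D\<^sub>\<alpha>(K(n,k,m))\<close> with respect to the partition of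
the vertices into the block \<open>K\<^bsub>n-k-m\<^esub>\<close> and the rest.\<close>

definition K_radius :: "real \<Rightarrow> nat \<Rightarrow> nat \<Rightarrow> nat \<Rightarrow> real" where
  "K_radius \<alpha> n k m =
     (real n - 2 + \<alpha> * n + \<alpha> * m +
        sqrt ((real n - \<alpha> * n - \<alpha> * m)\<^sup>2 + 4 * (1 - \<alpha>) * m * (real n - k - m))) / 2"

text \<open>The characteristic polynomial of that quotient matrix. The row sums of \<open>D\<^sub>\<alpha>(K(n,k,m))\<close> are \<open>n - 1\<close>
and, on the block \<open>K\<^bsub>n-k-m\<^esub>\<close>, \<open>n - 1 + m\<close>; writing the quotient matrix in the basis formed by the
all-ones vector and the indicator of the block gives this nearly factored form.\<close>

definition K_poly :: "real \<Rightarrow> nat \<Rightarrow> nat \<Rightarrow> nat \<Rightarrow> real \<Rightarrow> real" where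
  "K_poly \<alpha> n k m t = (t - n + 1) * (t - \<alpha> * n - \<alpha> * m + 1) - (1 - \<alpha>) * m * (real n - k - m)"

lemma K_poly_factored:
  fixes \<alpha> :: real
  assumes "\<alpha> < 1" "k + m \<le> n"
  shows "K_poly \<alpha> n k m t =
    (t - K_radius \<alpha> n k m) * (t - (real n - 2 + \<alpha> * n + \<alpha> * m - K_radius \<alpha> n k m))"
proof -
  define D where "D = (real n - \<alpha> * n - \<alpha> * m)\<^sup>2 + 4 * (1 - \<alpha>) * m * (real n - k - m)"
  have "real k + real m \<le> real n" using assms(2) by linarith
  then have "D \<ge> 0" using assms unfolding D_def by (intro add_nonneg_nonneg mult_nonneg_nonneg) auto
  then have s: "sqrt D * sqrt D = D" by simp
  show ?thesis unfolding K_radius_def K_poly_def D_def[symmetric]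
    using s unfolding D_def power2_eq_square by (simp add: field_simps)
qed

lemma K_radius_root:
  fixes \<alpha> :: real
  assumes "\<alpha> < 1" "k + m \<le> n"
  shows "K_poly \<alpha> n k m (K_radius \<alpha> n k m) = 0"
  by (simp add: K_poly_factored[OF assms])

lemma K_radius_gt:
  fixes \<alpha> :: real
  assumes "\<alpha> < 1" "k + m < n" "0 < m"
  shows "K_radius \<alpha> n k m > real n - 1"
proof -
  let ?q = "real n - \<alpha> * n - \<alpha> * m"
  have "real k + real m < real n" using assms(2) by linarith
  then have "4 * (1 - \<alpha>) * m * (real n - k - m) > 0" using assms by (intro mult_pos_pos) auto
  then have "?q\<^sup>2 < ?q\<^sup>2 + 4 * (1 - \<alpha>) * m * (real n - k - m)" by simp
  then have "\<bar>?q\<bar> < sqrt (?q\<^sup>2 + 4 * (1 - \<alpha>) * m * (real n - k - m))"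
    by (metis real_sqrt_abs real_sqrt_less_mono)
  then have "?q < sqrt (?q\<^sup>2 + 4 * (1 - \<alpha>) * m * (real n - k - m))" by linarith
  then show ?thesis unfolding K_radius_def by (simp add: field_simps)
qed

lemma K_radius_other_root:
  fixes \<alpha> :: real
  assumes "\<alpha> < 1" "k + m \<le> n"
  shows "real n - 2 + \<alpha> * n + \<alpha> * m - K_radius \<alpha> n k m \<le> K_radius \<alpha> n k m"
proof -
  have "real k + real m \<le> real n" using assms(2) by linarith
  then have "(real n - \<alpha> * n - \<alpha> * m)\<^sup>2 + 4 * (1 - \<alpha>) * m * (real n - k - m) \<ge> 0"
    using assms by (intro add_nonneg_nonneg mult_nonneg_nonneg) auto
  then show ?thesis unfolding K_radius_def by (simp add: field_simps)
qed

lemma K_poly_diff: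
  "K_poly \<alpha> n k 1 t - K_poly \<alpha> n k m t =
     (real m - 1) * (\<alpha> * (t - n + 1) + (1 - \<alpha>) * (real n - k - m - 1))"
  unfolding K_poly_def by (simp add: algebra_simps)

text \<open>The polynomial for \<open>m\<close> is nonpositive at the larger root \<open>t\<close> of the polynomial for \<open>1\<close>, so its own
larger root is at least \<open>t\<close>. By \<open>K_poly_diff\<close> the value at \<open>t\<close> is \<open>-(m - 1)\<close> times a sum of two nonnegative
terms. As \<open>t > n - 1\<close>, the first term vanishes only for \<open>\<alpha> = 0\<close>, and the second only for
\<open>m = n - k - 1\<close>.\<close>

lemma K_radius_mono:
  fixes \<alpha> :: real
  assumes "0 \<le> \<alpha>" "\<alpha> < 1" "k + m < n" "1 \<le> m"
  shows "K_radius \<alpha> n k 1 \<le> K_radius \<alpha> n k m"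
    and "K_radius \<alpha> n k 1 = K_radius \<alpha> n k m \<longleftrightarrow> m = 1 \<or> \<alpha> = 0 \<and> m = n - k - 1"
proof -
  let ?t = "K_radius \<alpha> n k 1"
  have t: "?t > real n - 1" using assms by (intro K_radius_gt) auto
  have km: "real k + real m + 1 \<le> real n" using assms(3) by linarith
  have m: "real m \<ge> 1" using assms by simp
  let ?d = "\<alpha> * (?t - n + 1) + (1 - \<alpha>) * (real n - k - m - 1)"
  have d1: "\<alpha> * (?t - n + 1) \<ge> 0" using assms(1) t by (intro mult_nonneg_nonneg) auto
  have d2: "(1 - \<alpha>) * (real n - k - m - 1) \<ge> 0" using assms(2) km by (intro mult_nonneg_nonneg) auto
  have d: "?d \<ge> 0" using d1 d2 by linarith
  have p: "K_poly \<alpha> n k m ?t = - ((real m - 1) * ?d)"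
    using K_poly_diff[of \<alpha> n k ?t m] K_radius_root[of \<alpha> k 1 n] assms by simp
  show le: "?t \<le> K_radius \<alpha> n k m"
  proof (rule ccontr)
    assume "\<not> ?thesis"
    then have "K_poly \<alpha> n k m ?t > 0"
      using K_radius_other_root[of \<alpha> k m n] assms
      by (subst K_poly_factored) (auto intro!: mult_pos_pos)
    then show False using p mult_nonneg_nonneg[of "real m - 1" ?d] m d by linarith
  qed
  show "?t = K_radius \<alpha> n k m \<longleftrightarrow> m = 1 \<or> \<alpha> = 0 \<and> m = n - k - 1"
  proof
    assume "?t = K_radius \<alpha> n k m"
    then have "(real m - 1) * ?d = 0" using K_radius_root[of \<alpha> k m n] assms p by simp
    then consider "m = 1" | "?d = 0" by auto
    then show "m = 1 \<or> \<alpha> = 0 \<and> m = n - k - 1"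
    proof cases
      case 2
      with d1 d2 have "\<alpha> * (?t - n + 1) = 0" "(1 - \<alpha>) * (real n - k - m - 1) = 0" by linarith+
      then have "\<alpha> = 0" "real n - k - m - 1 = 0" using t assms by auto
      then show ?thesis by linarith
    qed simp
  next
    assume "m = 1 \<or> \<alpha> = 0 \<and> m = n - k - 1"
    then show "?t = K_radius \<alpha> n k m"
    proof
      assume "\<alpha> = 0 \<and> m = n - k - 1"
      moreover have "real (n - k - 1) = real n - k - 1" using assms by (simp add: of_nat_diff)
      ultimately show ?thesis using assms by (simp add: K_radius_def)
    qed simp
  qed
qed

section \<open>Comparison with the extremal digraphs\<close>

lemma D_alpha_entry:
  assumes "i < length vs" "j < length vs"
  shows "D_alpha \<alpha> G vs $$ (i, j) = (1 - \<alpha>) * ddist G (vs ! i) (vs ! j) +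
           (if i = j then \<alpha> * transmission G (vs ! i) else 0)"
  using assms by (auto simp: D_alpha_def Diag_Tr_def distance_matrix_def mat_diag_def)

lemma D_alpha_carrier: "D_alpha \<alpha> G vs \<in> carrier_mat (length vs) (length vs)"
  by (auto simp: D_alpha_def Diag_Tr_def distance_matrix_def mat_diag_def)

text \<open>Splitting the transmission into distances turns a row of \<open>D\<^sub>\<alpha> z\<close> into a sum of distances with the
weights \<open>\<alpha> z\<^sub>u + (1 - \<alpha>) z\<^sub>v\<close>. For positive \<open>z\<close> and \<open>0 \<le> \<alpha> < 1\<close> the weights are positive,
hence each row is strictly increasing in every distance.\<close>

lemma D_alpha_row:
  fixes z :: "'a \<Rightarrow> real" and \<alpha> :: real
  assumes vs: "distinct vs" "set vs = verts G" and i: "i < length vs"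
  shows "(\<Sum>j<length vs. D_alpha \<alpha> G vs $$ (i, j) * z (vs ! j)) =
    (\<Sum>v\<in>verts G. ddist G (vs ! i) v * (\<alpha> * z (vs ! i) + (1 - \<alpha>) * z v))"
proof -
  have bij: "bij_betw (nth vs) {..<length vs} (verts G)"
    using bij_betw_nth[OF vs(1), of "{..<length vs}" "verts G"] vs(2) by simp
  have "(\<Sum>j<length vs. D_alpha \<alpha> G vs $$ (i, j) * z (vs ! j)) =
    (\<Sum>j<length vs. (1 - \<alpha>) * ddist G (vs ! i) (vs ! j) * z (vs ! j) +
      (if i = j then \<alpha> * transmission G (vs ! i) * z (vs ! i) else 0))"
    using i by (intro sum.cong) (auto simp: D_alpha_entry algebra_simps)
  also have "\<dots> = (\<Sum>j<length vs. (1 - \<alpha>) * ddist G (vs ! i) (vs ! j) * z (vs ! j)) +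
      \<alpha> * transmission G (vs ! i) * z (vs ! i)"
    using i by (simp add: sum.distrib)
  also have "(\<Sum>j<length vs. (1 - \<alpha>) * ddist G (vs ! i) (vs ! j) * z (vs ! j)) =
    (\<Sum>v\<in>verts G. (1 - \<alpha>) * ddist G (vs ! i) v * z v)"
    by (rule sum.reindex_bij_betw[OF bij])
  also have "\<dots> + \<alpha> * transmission G (vs ! i) * z (vs ! i) =
    (\<Sum>v\<in>verts G. ddist G (vs ! i) v * (\<alpha> * z (vs ! i) + (1 - \<alpha>) * z v))"
    by (simp add: transmission_def sum_distrib_left sum_distrib_right sum.distrib sum_subtractf algebra_simps)
  finally show ?thesis .
qed

text \<open>The least distances compatible with the absence of arcs from \<open>B\<close> to \<open>M\<close>.\<close>

definition forced_dist :: "'a set \<Rightarrow> 'a set \<Rightarrow> 'a \<Rightarrow> 'a \<Rightarrow> nat" where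
  "forced_dist B M u v = (if u = v then 0 else if u \<in> B \<and> v \<in> M then 2 else 1)"

text \<open>The Perron vector of \<open>K(n,k,m)\<close>, scaled to 1 outside the block \<open>B\<close>. Its value on \<open>B\<close> is
read off from the rows outside \<open>B\<close>, which give \<open>n - 1 + (1 - \<alpha>) (n - k - m) \<delta> = \<mu>\<close> for the
entry \<open>1 + \<delta>\<close>.\<close>

definition K_perron :: "real \<Rightarrow> nat \<Rightarrow> nat \<Rightarrow> nat \<Rightarrow> 'a set \<Rightarrow> 'a \<Rightarrow> real" where
  "K_perron \<alpha> n k m B v =
     (if v \<in> B then 1 + (K_radius \<alpha> n k m - n + 1) / ((1 - \<alpha>) * (real n - k - m)) else 1)"

lemma K_perron_ge_1:
  fixes \<alpha> :: real
  assumes "\<alpha> < 1" "k + m < n" "0 < m"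
  shows "K_perron \<alpha> n k m B v \<ge> 1"
proof -
  have "real k + real m < real n" using assms by linarith
  then show ?thesis using K_radius_gt[OF assms] assms(1)
    by (auto simp: K_perron_def intro!: divide_nonneg_nonneg mult_nonneg_nonneg)
qed

text \<open>The eigenvalue equation of \<open>D\<^sub>\<alpha>(K(n,k,m))\<close>. Outside \<open>B\<close> it is the choice of \<open>\<delta>\<close>; on \<open>B\<close> it amounts to
\<open>\<delta> (\<mu> - \<alpha> n - \<alpha> m + 1) = m\<close>, which combined with that choice says that \<open>\<mu>\<close> is a root of \<open>K_poly\<close>.\<close>

lemma forced_dist_row:
  fixes \<alpha> :: real
  assumes V: "finite V" "card V = n" and BM: "B \<subseteq> V" "M \<subseteq> V" "B \<inter> M = {}"
    and card: "card B = n - k - m" "card M = m" and km: "k + m < n"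
    and \<alpha>: "\<alpha> < 1" and u: "u \<in> V"
  shows "(\<Sum>v\<in>V. forced_dist B M u v *
            (\<alpha> * K_perron \<alpha> n k m B u + (1 - \<alpha>) * K_perron \<alpha> n k m B v)) =
         K_radius \<alpha> n k m * K_perron \<alpha> n k m B u"
proof -
  let ?z = "K_perron \<alpha> n k m B" and ?\<mu> = "K_radius \<alpha> n k m"
  define b where "b = real n - k - m"
  define \<delta> where "\<delta> = (?\<mu> - n + 1) / ((1 - \<alpha>) * b)"
  have z: "?z v = 1 + (if v \<in> B then \<delta> else 0)" for v by (simp add: K_perron_def \<delta>_def b_def)
  have b: "b > 0" "real (card B) = b" using km card by (auto simp: b_def of_nat_diff)
  have \<delta>: "(1 - \<alpha>) * b * \<delta> = ?\<mu> - n + 1" using \<alpha> b by (simp add: \<delta>_def)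
  have "(1 - \<alpha>) * b * (\<delta> * (?\<mu> - \<alpha> * n - \<alpha> * m + 1)) = (1 - \<alpha>) * b * m"
  proof -
    have "(1 - \<alpha>) * b * (\<delta> * (?\<mu> - \<alpha> * n - \<alpha> * m + 1)) =
        ((1 - \<alpha>) * b * \<delta>) * (?\<mu> - \<alpha> * n - \<alpha> * m + 1)" by (simp only: mult.assoc)
    also have "\<dots> = (1 - \<alpha>) * m * b"
      unfolding \<delta> using K_radius_root[of \<alpha> k m n] \<alpha> km by (simp add: K_poly_def b_def)
    finally show ?thesis by (simp only: mult_ac)
  qed
  then have m: "\<delta> * (?\<mu> - \<alpha> * n - \<alpha> * m + 1) = m" using \<alpha> b by simp
  have fin: "finite B" "finite M" using V BM finite_subset by blast+
  have sB: "(\<Sum>v\<in>V. if v \<in> B then c else 0) = b * c" for c :: real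
    using BM b V by (simp add: sum.If_cases Int_absorb1)
  have sM: "(\<Sum>v\<in>V. if v \<in> M then c else 0) = m * c" for c :: real
    using BM V card by (simp add: sum.If_cases Int_absorb1)
  let ?w = "\<lambda>v. \<alpha> * ?z u + (1 - \<alpha>) * ?z v"
  have split: "forced_dist B M u v * ?w v =
    ?w v - (if v = u then ?w u else 0) + (if u \<in> B then (if v \<in> M then \<alpha> * ?z u + (1 - \<alpha>) else 0) else 0)"
    if "v \<in> V" for v
    using BM that by (auto simp: forced_dist_def z)
  have "(\<Sum>v\<in>V. forced_dist B M u v * ?w v) =
     (\<Sum>v\<in>V. ?w v) - ?w u + (if u \<in> B then m * (\<alpha> * ?z u + (1 - \<alpha>)) else 0)"
    using V u by (simp add: split sum.distrib sum_subtractf sM)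
  also have "(\<Sum>v\<in>V. ?w v) = n * \<alpha> * ?z u + (1 - \<alpha>) * (n + b * \<delta>)"
    using V by (simp add: sum.distrib sum_distrib_left[symmetric] z sB)
  also have "n * \<alpha> * ?z u + (1 - \<alpha>) * (n + b * \<delta>) - ?w u +
      (if u \<in> B then m * (\<alpha> * ?z u + (1 - \<alpha>)) else 0) = ?\<mu> * ?z u"
  proof (cases "u \<in> B")
    case True
    have "n * \<alpha> * (1 + \<delta>) + (1 - \<alpha>) * (n + b * \<delta>) - (\<alpha> * (1 + \<delta>) + (1 - \<alpha>) * (1 + \<delta>)) +
        m * (\<alpha> * (1 + \<delta>) + (1 - \<alpha>)) - ?\<mu> * (1 + \<delta>) =
        ((1 - \<alpha>) * b * \<delta> - (?\<mu> - n + 1)) + (m - \<delta> * (?\<mu> - \<alpha> * n - \<alpha> * m + 1))"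
      by (simp add: algebra_simps)
    also have "\<dots> = 0" using \<delta> m by simp
    finally have "n * \<alpha> * (1 + \<delta>) + (1 - \<alpha>) * (n + b * \<delta>) - (\<alpha> * (1 + \<delta>) + (1 - \<alpha>) * (1 + \<delta>)) +
        m * (\<alpha> * (1 + \<delta>) + (1 - \<alpha>)) = ?\<mu> * (1 + \<delta>)" by simp
    then show ?thesis using True by (simp add: z)
  next
    case False
    have "n * \<alpha> * 1 + (1 - \<alpha>) * (n + b * \<delta>) - (\<alpha> * 1 + (1 - \<alpha>) * 1) =
        (1 - \<alpha>) * b * \<delta> + n - 1"
      by (simp add: algebra_simps)
    also have "\<dots> = ?\<mu> * 1" unfolding \<delta> by simp
    finally show ?thesis using False by (simp add: z)
  qed
  finally show ?thesis .
qed

context digraph begin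

lemma ddist_ge_forced:
  assumes sc: "strongly_connected G"
    and no: "\<And>u v. u \<in> B \<Longrightarrow> v \<in> M \<Longrightarrow> \<not> u \<rightarrow> v"
    and uv: "u \<in> verts G" "v \<in> verts G"
  shows "ddist G u v \<ge> forced_dist B M u v"
proof -
  have "u \<rightarrow>\<^sup>* v" using sc uv by blast
  then show ?thesis using ddist_ge_1 ddist_ge_2 no by (auto simp: forced_dist_def)
qed

text \<open>If all other arcs are present, a vertex outside \<open>B \<union> M\<close> provides the paths of length 2 from \<open>B\<close> to \<open>M\<close>.
Conversely a missing arc elsewhere forces a distance of at least 2 where 1 is expected.\<close>

lemma ddist_eq_forced_iff:
  assumes sc: "strongly_connected G"
    and BM: "B \<subseteq> verts G" "M \<subseteq> verts G" "B \<inter> M = {}" "B \<union> M \<noteq> verts G"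
    and no: "\<And>u v. u \<in> B \<Longrightarrow> v \<in> M \<Longrightarrow> \<not> u \<rightarrow> v"
  shows "(\<forall>u\<in>verts G. \<forall>v\<in>verts G. ddist G u v = forced_dist B M u v) \<longleftrightarrow> complete_except G B M"
proof
  {
    assume d: "\<forall>u\<in>verts G. \<forall>v\<in>verts G. ddist G u v = forced_dist B M u v"
    have "u \<rightarrow> v" if uv: "u \<in> verts G" "v \<in> verts G" "u \<noteq> v" "\<not> (u \<in> B \<and> v \<in> M)" for u v
    proof (rule ccontr)
      assume "\<not> u \<rightarrow> v"
      moreover have "u \<rightarrow>\<^sup>* v" using sc uv by blast
      ultimately have "ddist G u v \<ge> 2" using ddist_ge_2 uv by blast
      then show False using d uv by (auto simp: forced_dist_def)
    qed
    then show "complete_except G B M"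
      unfolding complete_except_def using no adj_in_verts adj_not_same by blast
  }
  assume K: "complete_except G B M"
  obtain w where w: "w \<in> verts G" "w \<notin> B" "w \<notin> M" using BM by blast
  show "\<forall>u\<in>verts G. \<forall>v\<in>verts G. ddist G u v = forced_dist B M u v"
  proof (intro ballI)
    fix u v assume uv: "u \<in> verts G" "v \<in> verts G"
    consider "u = v" | "u \<noteq> v" "u \<in> B" "v \<in> M" | "u \<noteq> v" "\<not> (u \<in> B \<and> v \<in> M)" by blast
    then show "ddist G u v = forced_dist B M u v"
    proof cases
      case 2
      then have "u \<rightarrow> w" "w \<rightarrow> v" "\<not> u \<rightarrow> v" using K w uv unfolding complete_except_def by auto
      then show ?thesis using ddist_eq_2 2 by (auto simp: forced_dist_def)
    next
      case 3
      then have "u \<rightarrow> v" using K uv unfolding complete_except_def by auto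
      then show ?thesis using ddist_adj 3 by (auto simp: forced_dist_def)
    qed (use uv ddist_refl in \<open>auto simp: forced_dist_def\<close>)
  qed
qed

end

text \<open>The Perron vector of \<open>K(n,k,m)\<close> is the test vector: the distances of \<open>G\<close> dominate those of \<open>K(n,k,m)\<close>,
so it is subinvariant for \<open>D\<^sub>\<alpha>(G)\<close>, strictly so in some coordinate unless all distances agree.\<close>

theorem mu_alpha_ge_K_radius:
  assumes G: "digraph G" and sc: "strongly_connected G" and n: "card (verts G) = n"
    and vs: "distinct vs" "set vs = verts G"
    and BM: "B \<subseteq> verts G" "M \<subseteq> verts G" "B \<inter> M = {}"
    and no: "\<And>u v. u \<in> B \<Longrightarrow> v \<in> M \<Longrightarrow> (u, v) \<notin> arcs_ends G"
    and card: "card B = n - k - m" "card M = m"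
    and km: "k + m < n" "0 < k" "0 < m" and \<alpha>: "0 \<le> \<alpha>" "\<alpha> < 1"
  shows "mu_alpha \<alpha> G vs \<ge> K_radius \<alpha> n k m"
    and "mu_alpha \<alpha> G vs = K_radius \<alpha> n k m \<longleftrightarrow> complete_except G B M"
proof -
  interpret digraph G by (rule G)
  have len: "length vs = n" using vs n distinct_card by metis
  have in_V: "vs ! i \<in> verts G" if "i < n" for i using that len vs(2) nth_mem by metis
  let ?A = "D_alpha \<alpha> G vs" and ?\<mu> = "K_radius \<alpha> n k m" and ?z = "K_perron \<alpha> n k m B"
  let ?d = "\<lambda>u v. real (ddist G u v)" and ?e = "\<lambda>u v. real (forced_dist B M u v)"
  let ?w = "\<lambda>u v. \<alpha> * ?z u + (1 - \<alpha>) * ?z v"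
  have A: "?A \<in> carrier_mat n n" using D_alpha_carrier[of \<alpha> G vs] len by simp
  have nonneg: "?A $$ (i, j) \<ge> 0" if "i < n" "j < n" for i j
    using that \<alpha> len by (simp add: D_alpha_entry)
  have off: "?A $$ (i, j) > 0" if "i < n" "j < n" "i \<noteq> j" for i j
  proof -
    have "vs ! i \<noteq> vs ! j" using that vs(1) len by (simp add: nth_eq_iff_index_eq)
    moreover have "vs ! i \<rightarrow>\<^sup>*\<^bsub>G\<^esub> vs ! j" using sc in_V that by blast
    ultimately have "ddist G (vs ! i) (vs ! j) \<ge> 1" using ddist_ge_1 by blast
    then show ?thesis using that len \<alpha> by (simp add: D_alpha_entry)
  qed
  have z: "?z v \<ge> 1" for v by (rule K_perron_ge_1[OF \<alpha>(2) km(1,3)])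
  have w: "?w u v > 0" for u v
  proof -
    have "\<alpha> * ?z u \<ge> 0" "(1 - \<alpha>) * ?z v > 0"
      using z[of u] z[of v] \<alpha> by simp_all
    then show ?thesis by linarith
  qed
  have e: "(\<Sum>v\<in>verts G. ?e u v * ?w u v) = ?\<mu> * ?z u" if "u \<in> verts G" for u
    using forced_dist_row[of "verts G" n B M k m \<alpha> u] that n BM card km \<alpha> by auto
  have d: "(\<Sum>j<n. ?A $$ (i, j) * ?z (vs ! j)) = (\<Sum>v\<in>verts G. ?d (vs ! i) v * ?w (vs ! i) v)"
    if "i < n" for i using D_alpha_row[OF vs, of i \<alpha> ?z] that len by simp
  have de: "?d u v \<ge> ?e u v" if "u \<in> verts G" "v \<in> verts G" for u v
    using ddist_ge_forced[OF sc no that] by simp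
  have le: "?\<mu> * ?z u \<le> (\<Sum>v\<in>verts G. ?d u v * ?w u v)" if "u \<in> verts G" for u
    unfolding e[OF that, symmetric] using de that w by (intro sum_mono mult_right_mono) (auto simp: less_imp_le)
  have le': "?\<mu> * ?z (vs ! i) \<le> (\<Sum>j<n. ?A $$ (i, j) * ?z (vs ! j))" if "i < n" for i
    using le[OF in_V[OF that]] d[OF that] by simp
  have n0: "n > 0" using km by simp
  have z0: "?z v > 0" for v using z[of v] by linarith
  show ge: "mu_alpha \<alpha> G vs \<ge> ?\<mu>"
    unfolding mu_alpha_def
    using spectral_radius_ge_subinvariant[OF A nonneg, of "\<lambda>i. ?z (vs ! i)" 0 ?\<mu>] z0 n0 le'
    by (simp add: less_imp_le)
  have fin: "finite B" "finite M" using BM finite_subset finite_verts by blast+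
  have "card (B \<union> M) = n - k" using BM card fin km by (simp add: card_Un_disjoint)
  then have "B \<union> M \<noteq> verts G" using n km by auto
  note forced = ddist_eq_forced_iff[OF sc BM this no]
  show "mu_alpha \<alpha> G vs = ?\<mu> \<longleftrightarrow> complete_except G B M"
  proof
    assume K: "complete_except G B M"
    have "(\<Sum>j<n. ?A $$ (i, j) * ?z (vs ! j)) \<le> ?\<mu> * ?z (vs ! i)" if "i < n" for i
    proof -
      have "(\<Sum>v\<in>verts G. ?d (vs ! i) v * ?w (vs ! i) v) = (\<Sum>v\<in>verts G. ?e (vs ! i) v * ?w (vs ! i) v)"
        using forced K in_V[OF that] by (intro sum.cong) auto
      then show ?thesis using d[OF that] e[OF in_V[OF that]] by simp
    qed
    then have "mu_alpha \<alpha> G vs \<le> ?\<mu>"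
      unfolding mu_alpha_def using z0 by (intro spectral_radius_le_superinvariant[OF A n0 nonneg]) auto
    then show "mu_alpha \<alpha> G vs = ?\<mu>" using ge by simp
  next
    assume eq: "mu_alpha \<alpha> G vs = ?\<mu>"
    show "complete_except G B M"
    proof (rule ccontr)
      assume "\<not> complete_except G B M"
      then obtain u v where uv: "u \<in> verts G" "v \<in> verts G" "ddist G u v \<noteq> forced_dist B M u v"
        using forced by blast
      obtain i where i: "i < n" "vs ! i = u" using uv(1) vs(2) len by (metis in_set_conv_nth)
      have "?d u v > ?e u v" using de[OF uv(1,2)] uv(3) by simp
      then have "?\<mu> * ?z u < (\<Sum>v\<in>verts G. ?d u v * ?w u v)"
        unfolding e[OF uv(1), symmetric] using uv w de
        by (intro sum_strict_mono_ex1) (auto intro!: mult_right_mono simp: less_imp_le)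
      then have strict: "?\<mu> * ?z (vs ! i) < (\<Sum>j<n. ?A $$ (i, j) * ?z (vs ! j))"
        using d[OF i(1)] i by simp
      have "n \<ge> 3" using km by linarith
      from spectral_radius_gt_subinvariant[OF A this nonneg off, of "\<lambda>i. ?z (vs ! i)" ?\<mu> i] z0 le' i strict
      have "?\<mu> < mu_alpha \<alpha> G vs" unfolding mu_alpha_def by blast
      then show False using eq by simp
    qed
  qed
qed

text \<open>The definition of vertex connectivity provides a set \<open>S\<close> of size \<open>k\<close> whose deletion destroys strong
connectivity. It leaves at least two vertices, so the failure is not due to the null digraph.\<close>

lemma digraph_class_partition:
  assumes G: "G \<in> digraph_class n k" and k: "k \<le> n - 2" "1 \<le> k"
  obtains B M m where "B \<subseteq> verts G" "M \<subseteq> verts G" "B \<inter> M = {}"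
    "\<And>u v. u \<in> B \<Longrightarrow> v \<in> M \<Longrightarrow> (u, v) \<notin> arcs_ends G"
    "card B = n - k - m" "card M = m" "k + m < n" "0 < m"
proof -
  have dg: "digraph G" and n: "card (verts G) = n" and \<kappa>: "vertex_connectivity G = k"
    using G by (auto simp: digraph_class_def)
  interpret digraph G by (rule dg)
  have "\<not> complete_digraph (card (verts G)) G"
    using \<kappa> k n by (auto simp: vertex_connectivity_def)
  then have k_eq: "k = (LEAST k. \<exists>S\<subseteq>verts G. card S = k \<and> \<not> strongly_connected (G \<restriction> (verts G - S)))"
    using \<kappa> by (simp add: vertex_connectivity_def)
  \<comment> \<open>Deleting all vertices leaves the null digraph, so the set of candidate sizes is nonempty.\<close>
  have "\<exists>k. \<exists>S\<subseteq>verts G. card S = k \<and> \<not> strongly_connected (G \<restriction> (verts G - S))"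
    by (intro exI[of _ "card (verts G)"] exI[of _ "verts G"]) (auto simp: strongly_connected_def)
  from LeastI_ex[OF this, folded k_eq] obtain S where S: "S \<subseteq> verts G" "card S = k"
    "\<not> strongly_connected (G \<restriction> (verts G - S))" by blast
  have cS: "card (verts G - S) = n - k"
    using S n by (simp add: card_Diff_subset finite_subset[OF S(1)])
  then have "card (verts G - S) > 0" using k by linarith
  then have "verts G - S \<noteq> {}" by (metis card.empty less_irrefl)
  from disconnecting_partition[OF dg S(1,3) this] obtain B M where BM: "B \<union> M = verts G - S"
    "B \<inter> M = {}" "B \<noteq> {}" "M \<noteq> {}"
    "\<And>u v. u \<in> B \<Longrightarrow> v \<in> M \<Longrightarrow> (u, v) \<notin> arcs_ends G" by metis
  have fin: "finite B" "finite M" using BM(1) finite_verts by (metis finite_Diff finite_Un)+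
  have "card B + card M = n - k" using card_Un_disjoint[OF fin BM(2)] BM(1) cS by simp
  moreover have "card B > 0" "card M > 0" using fin BM by (auto simp: card_gt_0_iff)
  ultimately show thesis using BM by (intro that[of B M "card M"]) auto
qed

lemma mu_alpha_K_digraph:
  assumes G: "digraph G" and sc: "strongly_connected G"
    and vs: "distinct vs" "set vs = verts G"
    and km: "k + m < n" "0 < k" "0 < m" and \<alpha>: "0 \<le> \<alpha>" "\<alpha> < 1"
    and iso: "digraph_iso G (with_proj (K_digraph n k m))"
  shows "mu_alpha \<alpha> G vs = K_radius \<alpha> n k m"
proof -
  obtain B M where BM: "B \<subseteq> verts G" "M \<subseteq> verts G" "B \<inter> M = {}" "card B = n - k - m" "card M = m"
    "complete_except G B M" and n: "card (verts G) = n"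
    using iso km unfolding digraph_iso_K_digraph_iff[OF G less_imp_le[OF km(1)]] by blast
  have "(u, v) \<notin> arcs_ends G" if "u \<in> B" "v \<in> M" for u v
    using BM(6) that by (auto simp: complete_except_def)
  from mu_alpha_ge_K_radius(2)[OF G sc n vs BM(1-3) this BM(4,5) km \<alpha>] BM(6) show ?thesis by simp
qed

section \<open>Minimising over the class\<close>

theorem mu_alpha_ge_K_radius_1:
  assumes k: "1 \<le> k" "k \<le> n - 2" and G: "G \<in> digraph_class n k"
    and vs: "distinct vs" "set vs = verts G" and \<alpha>: "0 \<le> \<alpha>" "\<alpha> < 1"
  shows "mu_alpha \<alpha> G vs \<ge> K_radius \<alpha> n k 1"
    and "mu_alpha \<alpha> G vs = K_radius \<alpha> n k 1 \<longleftrightarrow>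
      digraph_iso G (with_proj (K_digraph n k 1)) \<or>
      \<alpha> = 0 \<and> digraph_iso G (with_proj (K_digraph n k (n - k - 1)))"
proof -
  have dg: "digraph G" and sc: "strongly_connected G" and n: "card (verts G) = n"
    using G by (auto simp: digraph_class_def)
  obtain B M m where BM: "B \<subseteq> verts G" "M \<subseteq> verts G" "B \<inter> M = {}"
    "\<And>u v. u \<in> B \<Longrightarrow> v \<in> M \<Longrightarrow> (u, v) \<notin> arcs_ends G"
    "card B = n - k - m" "card M = m" and km: "k + m < n" "0 < m"
    using digraph_class_partition[OF G k(2,1)] by metis
  have k0: "0 < k" and m1: "1 \<le> m" using k km by auto
  note lower = mu_alpha_ge_K_radius[OF dg sc n vs BM km(1) k0 km(2) \<alpha>]
  note mono = K_radius_mono[OF \<alpha> km(1) m1]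
  show "mu_alpha \<alpha> G vs \<ge> K_radius \<alpha> n k 1" using lower mono by linarith
  show "mu_alpha \<alpha> G vs = K_radius \<alpha> n k 1 \<longleftrightarrow>
      digraph_iso G (with_proj (K_digraph n k 1)) \<or>
      \<alpha> = 0 \<and> digraph_iso G (with_proj (K_digraph n k (n - k - 1)))"
    (is "?L \<longleftrightarrow> ?R")
  proof
    assume ?L
    then have "mu_alpha \<alpha> G vs = K_radius \<alpha> n k m" "K_radius \<alpha> n k 1 = K_radius \<alpha> n k m"
      using lower mono by linarith+
    then have "complete_except G B M" and m: "m = 1 \<or> \<alpha> = 0 \<and> m = n - k - 1"
      using lower mono by blast+
    then have "digraph_iso G (with_proj (K_digraph n k m))"
      unfolding digraph_iso_K_digraph_iff[OF dg less_imp_le[OF km(1)]] using n BM by blast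
    then show ?R using m by auto
  next
    assume ?R
    then show ?L
    proof
      assume "digraph_iso G (with_proj (K_digraph n k 1))"
      then show ?L using mu_alpha_K_digraph[OF dg sc vs _ k0 _ \<alpha>, of 1 n] km by simp
    next
      assume *: "\<alpha> = 0 \<and> digraph_iso G (with_proj (K_digraph n k (n - k - 1)))"
      have "k + (n - k - 1) < n" "1 \<le> n - k - 1" using k by auto
      then have "mu_alpha \<alpha> G vs = K_radius \<alpha> n k (n - k - 1)"
        "K_radius \<alpha> n k 1 = K_radius \<alpha> n k (n - k - 1)"
        using * mu_alpha_K_digraph[OF dg sc vs _ k0 _ \<alpha>, of "n - k - 1" n]
          K_radius_mono(2)[OF \<alpha>, of k "n - k - 1" n] by auto
      then show ?L by simp
    qed
  qed
qed

lemma K_radius_1_eq: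
  "K_radius \<alpha> n k 1 = (real n - 2 + \<alpha> + \<alpha> * real n +
            sqrt ((1 - \<alpha>)\<^sup>2 * (real n)\<^sup>2 + (2 * \<alpha>\<^sup>2 - 6 * \<alpha> + 4) * real n +
                  (\<alpha>\<^sup>2 + 4 * \<alpha> - 4) - 4 * (1 - \<alpha>) * real k)) / 2"
proof -
  have "(real n - \<alpha> * n - \<alpha> * real 1)\<^sup>2 + 4 * (1 - \<alpha>) * real 1 * (real n - k - real 1) =
    (1 - \<alpha>)\<^sup>2 * (real n)\<^sup>2 + (2 * \<alpha>\<^sup>2 - 6 * \<alpha> + 4) * real n +
      (\<alpha>\<^sup>2 + 4 * \<alpha> - 4) - 4 * (1 - \<alpha>) * real k"
    by (simp add: power2_eq_square ring_distribs)
  moreover have "real n - 2 + \<alpha> * n + \<alpha> * real 1 = real n - 2 + \<alpha> + \<alpha> * real n" by simp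
  ultimately show ?thesis unfolding K_radius_def by presburger
qed

theorem theorem4p5:
  fixes n k :: nat and \<alpha> :: real and G :: "('a, 'b) pre_digraph" and vs :: "'a list"
  assumes "1 \<le> k" and "k \<le> n - 2"
    and "G \<in> digraph_class n k"
    and "distinct vs" and "set vs = verts G"
  shows
    "(\<alpha> = 0 \<longrightarrow>
        mu_alpha \<alpha> G vs \<ge>
          (real n - 2 + sqrt ((real n)\<^sup>2 + 4 * real n - 4 * real k - 4)) / 2 \<and>
        (mu_alpha \<alpha> G vs =
           (real n - 2 + sqrt ((real n)\<^sup>2 + 4 * real n - 4 * real k - 4)) / 2 \<longleftrightarrow>
         digraph_iso G (with_proj (K_digraph n k (n - k - 1))) \<or>
         digraph_iso G (with_proj (K_digraph n k 1)))) \<and>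
     (0 < \<alpha> \<and> \<alpha> \<le> 4 / 5 \<longrightarrow>
        mu_alpha \<alpha> G vs \<ge>
          (real n - 2 + \<alpha> + \<alpha> * real n +
            sqrt ((1 - \<alpha>)\<^sup>2 * (real n)\<^sup>2 + (2 * \<alpha>\<^sup>2 - 6 * \<alpha> + 4) * real n +
                  (\<alpha>\<^sup>2 + 4 * \<alpha> - 4) - 4 * (1 - \<alpha>) * real k)) / 2 \<and>
        (mu_alpha \<alpha> G vs =
           (real n - 2 + \<alpha> + \<alpha> * real n +
             sqrt ((1 - \<alpha>)\<^sup>2 * (real n)\<^sup>2 + (2 * \<alpha>\<^sup>2 - 6 * \<alpha> + 4) * real n +
                   (\<alpha>\<^sup>2 + 4 * \<alpha> - 4) - 4 * (1 - \<alpha>) * real k)) / 2 \<longleftrightarrow>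
         digraph_iso G (with_proj (K_digraph n k 1))))"
proof -
  have bound: "mu_alpha \<alpha> G vs \<ge> K_radius \<alpha> n k 1"
    "mu_alpha \<alpha> G vs = K_radius \<alpha> n k 1 \<longleftrightarrow>
      digraph_iso G (with_proj (K_digraph n k 1)) \<or>
      \<alpha> = 0 \<and> digraph_iso G (with_proj (K_digraph n k (n - k - 1)))"
    if "0 \<le> \<alpha>" "\<alpha> < 1"
    using mu_alpha_ge_K_radius_1[OF assms that] by blast+
  have "(real n)\<^sup>2 + 4 * real n - 4 * real k - 4 =
      (1 - 0)\<^sup>2 * (real n)\<^sup>2 + (2 * 0\<^sup>2 - 6 * 0 + 4) * real n + (0\<^sup>2 + 4 * 0 - 4) - 4 * (1 - 0) * real k"
    by simp
  then have zero: "(real n - 2 + sqrt ((real n)\<^sup>2 + 4 * real n - 4 * real k - 4)) / 2 = K_radius 0 n k 1"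
    unfolding K_radius_1_eq by simp
  show ?thesis
    unfolding zero K_radius_1_eq[symmetric]
  proof (intro conjI impI; (elim conjE)?)
    assume "\<alpha> = 0"
    then show "mu_alpha \<alpha> G vs \<ge> K_radius 0 n k 1"
      "mu_alpha \<alpha> G vs = K_radius 0 n k 1 \<longleftrightarrow>
        digraph_iso G (with_proj (K_digraph n k (n - k - 1))) \<or> digraph_iso G (with_proj (K_digraph n k 1))"
      using bound by auto
  next
    assume "0 < \<alpha>" "\<alpha> \<le> 4 / 5"
    then show "mu_alpha \<alpha> G vs \<ge> K_radius \<alpha> n k 1"
      "mu_alpha \<alpha> G vs = K_radius \<alpha> n k 1 \<longleftrightarrow> digraph_iso G (with_proj (K_digraph n k 1))"
      using bound by auto
  qed
qed

end
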